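(* Let $\nu>0$, $0\le q'\le1$, and $q=1+\frac{2}{\nu+d}$. Let the prior be $$p_0(\mathbf{w})=\frac1{Z_0}\left(1+\frac1\nu\|\mathbf{w}\|_2^2\right)^{-\frac{\nu+d}{2}},\qquad Z_0=\frac{\Gamma(\nu/2)\,\nu^{d/2}\pi^{d/2}}{\Gamma((\nu+d)/2)},$$ and let the posterior have the form $$p(\mathbf{w})=\frac{1}{Z_0c^{d/2}}\left(1+\frac{1}{\nu c}\|\mathbf{w}-\boldsymbol{\mu}\|_2^2\right)^{-\frac{\nu+d}{2}},\qquad c=1-\frac1\nu\|\boldsymbol{\mu}\|_2^2 .$$ Then the problem $$\min_{p(\mathbf{w}),\,\mathbf{z}}\; D_q(p(\mathbf{w})\|p_0(\mathbf{w}))+C\sum_{i=1}^{m}\exp_{q'}(-z_i)$$ $$\text{s.t.}\quad z_i=\int y_i\,\mathbf{f}_i^T\mathbf{w}\;p^q(\mathbf{w})\,d\mathbf{w}\quad(i=1,\dots,m),\qquad \int p(\mathbf{w})\,d\mathbf{w}=1$$ can be solved directly by optimizing the following problem over $\boldsymbol{\mu}\in\mathbb{R}^d$: $$\min_{\boldsymbol{\mu}}\;\frac12\left(1-\frac1\nu\|\boldsymbol{\mu}\|_2^2\right)^{-\frac{d}{\nu+d}}\left(\frac{\nu-d}{\nu}\|\boldsymbol{\mu}\|_2^2+\nu+d\right)-\frac{\nu+d}{2}+C\sum_{i=1}^m\exp_{q'}(-z_i)$$ $$\text{s.t.}\quad z_i=\frac{\nu^{\frac{\nu}{\nu+d}}\pi^{-\frac{d}{\nu+d}}}{\nu+d}\left(\frac{\Gamma(\frac{\nu+d}{2})}{\Gamma(\frac\nu2)}\right)^{\frac{2}{\nu+d}}\left(1-\frac1\nu\|\boldsymbol{\mu}\|_2^2\right)^{-\frac{d}{\nu+d}}y_i\,\mathbf{f}_i^T\boldsymbol{\mu},\qquad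 i=1,\dots,m,$$ where $\boldsymbol{\mu}$ is the posterior expectation of $\mathbf{w}$.
   Context: Data: instance-label pairs $(\mathbf{x}_i,y_i)$, $i=1,\dots,m$, with $\mathbf{x}_i\in\mathbb{R}^n$, $y_i\in\{-1,+1\}$; fixed basis functions $\phi_1,\dots,\phi_d$ on $\mathbb{R}^n$; feature vectors $\mathbf{f}_i=(\phi_1(\mathbf{x}_i),\dots,\phi_d(\mathbf{x}_i))^T\in\mathbb{R}^d$. $C>0$ is a constant. The variable $\mathbf{w}\in\mathbb{R}^d$ is a continuous random vector with normalized probability density $p(\mathbf{w})$; $p^q(\mathbf{w})$ means $(p(\mathbf{w}))^q$. $\mathbf{z}=(z_1,\dots,z_m)^T\in\mathbb{R}^m$. $\Gamma$ is the Gamma function. $q'$-exponential: with $[x]_+=\max\{x,0\}$, $\exp_{q'}x=[1+(1-q')x]_+^{\frac{1}{1-q'}}$ for $q'\ne1$ and $\exp_1x=\exp x$. Tsallis divergence between normalized densities (for $q\ne1$): $D_q(p(\mathbf{w})\|p_0(\mathbf{w}))=\frac{\int p^q(\mathbf{w})p_0^{1-q}(\mathbf{w})\,d\mathbf{w}-1}{q-1}$. The relation $\frac1{q-1}=\frac{\nu+d}{2}$ between $q$ and $\nu$ is a standing convention.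
   Formalization: For 0<ν≤1 the posterior has no expectation (e.g. Cauchy), so existence of the expectation is claimed for ν>1 and equality with μ whenever it exists; μ ranges over ‖μ‖²<ν, where c>0, and p over densities for which the integrals in D_q and the constraints exist. *)

theory Defs
  imports "HOL-Analysis.Analysis"
begin

text \<open>The \<open>q\<close>-exponential.  For \<open>q < 1\<close> the exponent is positive, so the convention
  \<open>0 powr a = 0\<close> gives the intended value where the truncation is active.\<close>

definition exp_q :: "real \<Rightarrow> real \<Rightarrow> real" where
  "exp_q q x = (if q = 1 then exp x else max 0 (1 + (1 - q) * x) powr (1 / (1 - q)))"

text \<open>The integral is meaningful only if the integrand is integrable, which
  \<open>med_feasible\<close> below demands.\<close>

definition tsallis_divergence ::
    "real \<Rightarrow> (real ^ 'd \<Rightarrow> real) \<Rightarrow> (real ^ 'd \<Rightarrow> real) \<Rightarrow> real" where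
  "tsallis_divergence q p p0 =
     ((\<integral>w. p w powr q * p0 w powr (1 - q) \<partial>lborel) - 1) / (q - 1)"

definition Z0 :: "real \<Rightarrow> nat \<Rightarrow> real" where
  "Z0 \<nu> d = Gamma (\<nu> / 2) * \<nu> powr (real d / 2) * pi powr (real d / 2)
            / Gamma ((\<nu> + real d) / 2)"

definition prior :: "real \<Rightarrow> real ^ 'd \<Rightarrow> real" where
  "prior \<nu> w = 1 / Z0 \<nu> CARD('d)
     * (1 + 1 / \<nu> * (norm w)\<^sup>2) powr (- ((\<nu> + real CARD('d)) / 2))"

definition post_scale :: "real \<Rightarrow> real ^ 'd \<Rightarrow> real" where
  "post_scale \<nu> \<mu> = 1 - 1 / \<nu> * (norm \<mu>)\<^sup>2"

definition posterior :: "real \<Rightarrow> real ^ 'd \<Rightarrow> real ^ 'd \<Rightarrow> real" where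
  "posterior \<nu> \<mu> w = 1 / (Z0 \<nu> CARD('d) * post_scale \<nu> \<mu> powr (real CARD('d) / 2))
     * (1 + 1 / (\<nu> * post_scale \<nu> \<mu>) * (norm (w - \<mu>))\<^sup>2) powr (- ((\<nu> + real CARD('d)) / 2))"

text \<open>The formula for \<open>posterior\<close> is a density only for positive scale, i.e. for
  \<open>\<mu>\<close> in the open ball of radius \<open>sqrt \<nu>\<close>.\<close>

definition posterior_family :: "real \<Rightarrow> (real ^ 'd \<Rightarrow> real) set" where
  "posterior_family \<nu> = {posterior \<nu> \<mu> | \<mu>. 0 < post_scale \<nu> \<mu>}"

definition feature_vec :: "('d \<Rightarrow> real ^ 'n \<Rightarrow> real) \<Rightarrow> real ^ 'n \<Rightarrow> real ^ 'd" where
  "feature_vec \<phi> x = (\<chi> j. \<phi> j x)"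

definition loss :: "real \<Rightarrow> real \<Rightarrow> real ^ 'm \<Rightarrow> real" where
  "loss C q' z = C * (\<Sum>i\<in>UNIV. exp_q q' (- z $ i))"

text \<open>The infinite-dimensional problem, over pairs of a probability density \<open>p\<close> and a
  vector \<open>z\<close>.  The integrals in the objective and in the constraints are required to exist,
  since Isabelle's integral of a non-integrable function is \<open>0\<close>; densities with infinite
  divergence are thereby excluded, as they cannot be minimizers.\<close>

definition med_feasible :: "real \<Rightarrow> (real ^ 'd \<Rightarrow> real) \<Rightarrow> ('m \<Rightarrow> real) \<Rightarrow> ('m \<Rightarrow> real ^ 'd)
    \<Rightarrow> (real ^ 'd \<Rightarrow> real) \<times> (real ^ 'm) \<Rightarrow> bool" where
  "med_feasible q p0 y f = (\<lambda>(p, z).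
     (\<forall>w. 0 \<le> p w) \<and>
     has_bochner_integral lborel p 1 \<and>
     integrable lborel (\<lambda>w. p w powr q * p0 w powr (1 - q)) \<and>
     (\<forall>i. has_bochner_integral lborel (\<lambda>w. y i * (f i \<bullet> w) * p w powr q) (z $ i)))"

definition med_objective :: "real \<Rightarrow> (real ^ 'd \<Rightarrow> real) \<Rightarrow> real \<Rightarrow> real
    \<Rightarrow> (real ^ 'd \<Rightarrow> real) \<times> (real ^ 'm) \<Rightarrow> real" where
  "med_objective q p0 C q' = (\<lambda>(p, z). tsallis_divergence q p p0 + loss C q' z)"

text \<open>The finite-dimensional problem, over pairs \<open>(\<mu>, z)\<close>.  Positivity of the scale is the
  domain on which its negative powers make sense.\<close>

definition red_feasible :: "real \<Rightarrow> ('m \<Rightarrow> real) \<Rightarrow> ('m \<Rightarrow> real ^ 'd)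
    \<Rightarrow> (real ^ 'd) \<times> (real ^ 'm) \<Rightarrow> bool" where
  "red_feasible \<nu> y f = (\<lambda>(\<mu>, z).
     0 < 1 - 1 / \<nu> * (norm \<mu>)\<^sup>2 \<and>
     (\<forall>i. z $ i =
        \<nu> powr (\<nu> / (\<nu> + real CARD('d))) * pi powr (- (real CARD('d) / (\<nu> + real CARD('d))))
          / (\<nu> + real CARD('d))
        * (Gamma ((\<nu> + real CARD('d)) / 2) / Gamma (\<nu> / 2)) powr (2 / (\<nu> + real CARD('d)))
        * (1 - 1 / \<nu> * (norm \<mu>)\<^sup>2) powr (- (real CARD('d) / (\<nu> + real CARD('d))))
        * (y i * (f i \<bullet> \<mu>))))"

definition red_objective :: "real \<Rightarrow> real \<Rightarrow> real \<Rightarrow> (real ^ 'd) \<times> (real ^ 'm) \<Rightarrow> real" where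
  "red_objective \<nu> C q' = (\<lambda>(\<mu>, z).
     1 / 2 * (1 - 1 / \<nu> * (norm \<mu>)\<^sup>2) powr (- (real CARD('d) / (\<nu> + real CARD('d))))
       * ((\<nu> - real CARD('d)) / \<nu> * (norm \<mu>)\<^sup>2 + \<nu> + real CARD('d))
     - (\<nu> + real CARD('d)) / 2 + loss C q' z)"

end

theory Submission
  imports Defs "HOL-Probability.Distributions"
begin

text \<open>For a density \<open>p\<close> write \<open>m(p) = \<integral> p\<^sup>q w\<close>. Since \<open>p0 powr (1 - q)\<close> is proportional to
  \<open>1 + (norm w)\<^sup>2 / \<nu>\<close>, the divergence is an increasing affine function of
  \<open>\<integral> p\<^sup>q (1 + (norm w)\<^sup>2 / \<nu>)\<close>, and the loss depends on \<open>p\<close> only through \<open>m(p)\<close>. For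
  \<open>r = posterior \<nu> \<mu>\<close> the choice of the scale makes \<open>r powr (1 - q)\<close> proportional to
  \<open>(1 + (norm w)\<^sup>2 / \<nu>) - 2 / \<nu> * (\<mu> \<bullet> w)\<close>. Hence Bernoulli's inequality
  \<open>p\<^sup>q r powr (1 - q) \<ge> r + q (p - r)\<close>, integrated, shows that \<open>r\<close> minimizes the divergence among all
  densities with the same value of \<open>m\<close>. As \<open>\<mu>\<close> runs through the ball of radius \<open>sqrt \<nu>\<close>, \<open>m(r)\<close>
  takes every value, so every feasible point is dominated by one in the posterior family. On that
  family all integrals are explicit, by \<open>\<integral> (1 + (norm w)\<^sup>2 / k) powr (- a) =
  (k * pi) powr (d / 2) * Gamma (a - d / 2) / Gamma a\<close>.\<close>

section \<open>Gaussian, Gamma and Student-t integrals\<close>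

lemma nn_integral_gaussian_real:
  fixes a m :: real
  assumes a: "0 < a"
  shows "(\<integral>\<^sup>+x. ennreal (exp (- a * (x - m)\<^sup>2)) \<partial>lborel) = ennreal ((pi / a) powr (1/2))"
proof -
  \<comment> \<open>With this standard deviation \<open>normal_density\<close> carries the exponent
    \<open>- a * (x - m)\<^sup>2\<close>.\<close>
  define \<sigma> where "\<sigma> = sqrt (1 / (2 * a))"
  have s: "0 < \<sigma>" "\<sigma>\<^sup>2 = 1 / (2 * a)" using a by (auto simp: \<sigma>_def)
  have eq: "exp (- a * (x - m)\<^sup>2) = (pi / a) powr (1/2) * normal_density m \<sigma> x" for x
    using a s(1) unfolding normal_density_def by (simp add: s(2) powr_half_sqrt field_simps)
  have "(\<integral>\<^sup>+x. ennreal (exp (- a * (x - m)\<^sup>2)) \<partial>lborel)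
      = (\<integral>\<^sup>+x. ennreal ((pi / a) powr (1/2)) * ennreal (normal_density m \<sigma> x) \<partial>lborel)"
    unfolding eq by (simp add: ennreal_mult')
  also have "\<dots> = ennreal ((pi / a) powr (1/2)) * (\<integral>\<^sup>+x. ennreal (normal_density m \<sigma> x) \<partial>lborel)"
    by (rule nn_integral_cmult) simp
  also have "(\<integral>\<^sup>+x. ennreal (normal_density m \<sigma> x) \<partial>lborel) = 1"
    using s by (subst nn_integral_eq_integral) auto
  finally show ?thesis by simp
qed

text \<open>The integrand factors over the coordinates, so the one-dimensional value is raised to
  the power of the dimension.\<close>

lemma nn_integral_gaussian:
  fixes \<mu> :: "'a::euclidean_space"
  assumes a: "0 < a"
  shows "(\<integral>\<^sup>+w. ennreal (exp (- a * (norm (w - \<mu>))\<^sup>2)) \<partial>lborel)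
       = ennreal ((pi / a) powr (real DIM('a) / 2))"
proof -
  have "exp (- a * (norm (w - \<mu>))\<^sup>2) = (\<Prod>b\<in>Basis. exp (- a * (w \<bullet> b - \<mu> \<bullet> b)\<^sup>2))" for w
  proof -
    have "- a * (norm (w - \<mu>))\<^sup>2 = (\<Sum>b\<in>Basis. - a * (w \<bullet> b - \<mu> \<bullet> b)\<^sup>2)"
      unfolding power2_norm_eq_inner
      by (subst euclidean_inner) (simp add: inner_diff_left power2_eq_square sum_distrib_left)
    thus ?thesis by (simp only: exp_sum finite_Basis)
  qed
  hence "(\<integral>\<^sup>+w. ennreal (exp (- a * (norm (w - \<mu>))\<^sup>2)) \<partial>lborel)
      = (\<integral>\<^sup>+w. (\<Prod>b\<in>Basis. ennreal (exp (- a * (w \<bullet> b - \<mu> \<bullet> b)\<^sup>2))) \<partial>lborel)"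
    by (simp add: prod_ennreal)
  also have "\<dots> = (\<Prod>b\<in>(Basis :: 'a set). (\<integral>\<^sup>+x. ennreal (exp (- a * (x - \<mu> \<bullet> b)\<^sup>2)) \<partial>lborel))"
    by (rule nn_integral_lborel_prod) auto
  also have "\<dots> = (\<Prod>b\<in>(Basis :: 'a set). ennreal ((pi / a) powr (1/2)))"
    by (simp only: nn_integral_gaussian_real[OF a])
  also have "\<dots> = ennreal (((pi / a) powr (1/2)) ^ DIM('a))"
    by (simp add: ennreal_power)
  also have "((pi / a) powr (1/2)) ^ DIM('a) = (pi / a) powr (real DIM('a) / 2)"
    using a by (simp add: powr_powr flip: powr_realpow)
  finally show ?thesis .
qed

text \<open>Substitute b t for t in Euler's integral for \<open>Gamma a\<close>.\<close>

lemma nn_integral_Gamma_scaled: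
  fixes a b :: real
  assumes a: "0 < a" and b: "0 < b"
  shows "(\<integral>\<^sup>+t. ennreal (indicator {0..} t * t powr (a - 1) * exp (- b * t)) \<partial>lborel)
       = ennreal (Gamma a * b powr (- a))"
proof -
  have "ennreal (Gamma a) =
      (\<integral>\<^sup>+t. ennreal (indicator {0..} t * t powr (a - 1) / exp t) \<partial>lborel)"
    by (rule Gamma_conv_nn_integral_real[OF a])
  also have "\<dots> = \<bar>b\<bar> * (\<integral>\<^sup>+t. ennreal (indicator {0..} (0 + b * t) * (0 + b * t) powr (a - 1) / exp (0 + b * t)) \<partial>lborel)"
    using b by (intro nn_integral_real_affine) auto
  also have "\<dots> = (\<integral>\<^sup>+t. ennreal b * ennreal (indicator {0..} (0 + b * t) * (0 + b * t) powr (a - 1) / exp (0 + b * t)) \<partial>lborel)"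
    using b by (subst nn_integral_cmult) auto
  also have "\<dots> = (\<integral>\<^sup>+t. ennreal (b powr a) * ennreal (indicator {0..} t * t powr (a - 1) * exp (- b * t)) \<partial>lborel)"
  proof (rule nn_integral_cong)
    fix t :: real
    have "b * (indicator {0..} (0 + b * t) * (0 + b * t) powr (a - 1) / exp (0 + b * t))
        = b powr a * (indicator {0..} t * t powr (a - 1) * exp (- b * t))"
    proof (cases "0 \<le> t")
      case True
      have "b * b powr (a - 1) = b powr a" using b by (simp add: powr_mult_base)
      with True b show ?thesis
        by (simp add: powr_mult exp_minus field_simps)
    next
      case False
      with b show ?thesis by (auto simp: indicator_def zero_le_mult_iff)
    qed
    thus "ennreal b * ennreal (indicator {0..} (0 + b * t) * (0 + b * t) powr (a - 1) / exp (0 + b * t))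
        = ennreal (b powr a) * ennreal (indicator {0..} t * t powr (a - 1) * exp (- b * t))"
      using b by (simp flip: ennreal_mult'')
  qed
  also have "\<dots> = ennreal (b powr a) * (\<integral>\<^sup>+t. ennreal (indicator {0..} t * t powr (a - 1) * exp (- b * t)) \<partial>lborel)"
    by (rule nn_integral_cmult) auto
  finally have *: "ennreal (Gamma a) = ennreal (b powr a) *
    (\<integral>\<^sup>+t. ennreal (indicator {0..} t * t powr (a - 1) * exp (- b * t)) \<partial>lborel)" (is "_ = _ * ?I") .
  have "ennreal (Gamma a * b powr (- a)) = ennreal (b powr (- a)) * ennreal (Gamma a)"
    using a by (subst mult.commute) (simp add: ennreal_mult')
  also have "\<dots> = ennreal (b powr (- a) * b powr a) * ?I"
    unfolding * by (simp add: ennreal_mult' mult.assoc)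
  also have "b powr (- a) * b powr a = 1" using b by (simp add: powr_minus)
  finally show ?thesis by simp
qed

text \<open>Writing the power as a Gamma integral over \<open>t\<close> and exchanging the integrals leaves a
  Gaussian integral over \<open>w\<close>.\<close>

lemma has_bochner_integral_student_kernel:
  fixes \<mu> :: "'a::euclidean_space"
  assumes a: "real DIM('a) / 2 < a" and k: "0 < k"
  shows "has_bochner_integral lborel (\<lambda>w. (1 + (norm (w - \<mu>))\<^sup>2 / k) powr (- a))
    ((k * pi) powr (real DIM('a) / 2) * Gamma (a - real DIM('a) / 2) / Gamma a)"
proof (rule has_bochner_integral_nn_integral)
  define d where "d = real DIM('a) / 2"
  have a0: "0 < a" "0 < a - d" using a by (auto simp: d_def intro: le_less_trans[of 0])
  have G: "0 < Gamma a" "0 < Gamma (a - d)" using a0 by simp_all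
  let ?g = "\<lambda>w. 1 + (norm (w - \<mu>))\<^sup>2 / k"
  have g: "0 < ?g w" for w using k by (simp add: add_pos_nonneg)
  have "ennreal (Gamma a) * (\<integral>\<^sup>+w. ennreal (?g w powr (- a)) \<partial>lborel)
      = (\<integral>\<^sup>+w. ennreal (Gamma a * ?g w powr (- a)) \<partial>lborel)"
    using a0 by (subst nn_integral_cmult[symmetric]) (auto simp: ennreal_mult')
  also have "\<dots> = (\<integral>\<^sup>+w. \<integral>\<^sup>+t. ennreal (indicator {0..} t * t powr (a - 1) * exp (- ?g w * t)) \<partial>lborel \<partial>lborel)"
    by (simp only: nn_integral_Gamma_scaled[OF a0(1) g])
  also have "\<dots> = (\<integral>\<^sup>+t. \<integral>\<^sup>+w. ennreal (indicator {0..} t * t powr (a - 1) * exp (- ?g w * t)) \<partial>lborel \<partial>lborel)"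
    by (rule lborel_pair.Fubini') simp
  also have "\<dots> = (\<integral>\<^sup>+t. ennreal ((k * pi) powr d) * ennreal (indicator {0..} t * t powr (a - d - 1) * exp (- 1 * t)) \<partial>lborel)"
  \<comment> \<open>The Gaussian formula needs the positive parameter t / k, so the null set t = 0
    is discarded; for t < 0 the indicator makes both sides vanish.\<close>
  proof (rule nn_integral_cong_AE, use AE_lborel_singleton[of "0::real"] in eventually_elim)
    fix t :: real assume t0: "t \<noteq> 0"
    show "(\<integral>\<^sup>+w. ennreal (indicator {0..} t * t powr (a - 1) * exp (- ?g w * t)) \<partial>lborel)
        = ennreal ((k * pi) powr d) * ennreal (indicator {0..} t * t powr (a - d - 1) * exp (- 1 * t))"
    proof (cases "0 < t")
      case True
      have "(\<integral>\<^sup>+w. ennreal (indicator {0..} t * t powr (a - 1) * exp (- ?g w * t)) \<partial>lborel)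
        = (\<integral>\<^sup>+w. ennreal (t powr (a - 1) * exp (- t)) * ennreal (exp (- (t / k) * (norm (w - \<mu>))\<^sup>2)) \<partial>lborel)"
        using True by (intro nn_integral_cong)
          (simp add: mult_exp_exp algebra_simps flip: ennreal_mult')
      also have "\<dots> = ennreal (t powr (a - 1) * exp (- t)) * ennreal ((pi / (t / k)) powr d)"
        unfolding d_def using nn_integral_gaussian[of "t / k" \<mu>] True k
        by (subst nn_integral_cmult) auto
      also have "\<dots> = ennreal (t powr (a - 1) * exp (- t) * (pi / (t / k)) powr d)"
        by (simp add: ennreal_mult')
      also have "t powr (a - 1) * exp (- t) * (pi / (t / k)) powr d
          = (k * pi) powr d * (indicator {0..} t * t powr (a - d - 1) * exp (- 1 * t))"
        using True k by (simp add: powr_divide powr_mult powr_diff powr_add field_simps)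
      finally show ?thesis by (simp add: ennreal_mult')
    next
      case False
      with t0 show ?thesis by simp
    qed
  qed
  also have "\<dots> = ennreal ((k * pi) powr d) * ennreal (Gamma (a - d) * 1 powr (- (a - d)))"
    by (subst nn_integral_cmult) (simp_all only: nn_integral_Gamma_scaled[OF a0(2) zero_less_one], auto)
  also have "\<dots> = ennreal ((k * pi) powr d * Gamma (a - d))"
    by (simp add: ennreal_mult')
  finally have *: "ennreal (Gamma a) * (\<integral>\<^sup>+w. ennreal (?g w powr (- a)) \<partial>lborel)
    = ennreal ((k * pi) powr d * Gamma (a - d))" .
  have "(\<integral>\<^sup>+w. ennreal (?g w powr (- a)) \<partial>lborel)
      = ennreal (1 / Gamma a * Gamma a) * (\<integral>\<^sup>+w. ennreal (?g w powr (- a)) \<partial>lborel)"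
    using G by simp
  also have "\<dots> = ennreal (1 / Gamma a) * ennreal ((k * pi) powr d * Gamma (a - d))"
    unfolding *[symmetric] using G by (subst ennreal_mult') (simp_all add: mult.assoc)
  also have "\<dots> = ennreal ((k * pi) powr d * Gamma (a - d) / Gamma a)"
    using G by (subst ennreal_mult'[symmetric]) auto
  finally show "(\<integral>\<^sup>+w. ennreal (?g w powr (- a)) \<partial>lborel)
    = ennreal ((k * pi) powr (real DIM('a) / 2) * Gamma (a - real DIM('a) / 2) / Gamma a)"
    by (simp add: d_def)
  show "0 \<le> (k * pi) powr (real DIM('a) / 2) * Gamma (a - real DIM('a) / 2) / Gamma a"
    using G by (simp add: d_def)
qed auto

section \<open>Reflection, tangent inequality and powers of the prior\<close>

text \<open>Lebesgue measure is invariant under reflection in the point \<mu>, so the integral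
  equals its own negative. This evaluates the centred first moments below.\<close>

lemma has_bochner_integral_reflect_odd:
  fixes h :: "'a::euclidean_space \<Rightarrow> 'b::{banach, second_countable_topology}"
  assumes h: "integrable lborel h" and odd: "\<And>w. h (2 *\<^sub>R \<mu> - w) = - h w"
  shows "has_bochner_integral lborel h 0"
proof -
  \<comment> \<open>The affine map has factor -1, whose Jacobian has absolute value 1.\<close>
  have refl: "lborel = distr lborel borel (\<lambda>w::'a. 2 *\<^sub>R \<mu> - w)"
    using lborel_affine[of "-1" "2 *\<^sub>R \<mu>"] by (simp add: density_1)
  have "integral\<^sup>L lborel h = integral\<^sup>L lborel (\<lambda>w. h (2 *\<^sub>R \<mu> - w))"
    using h by (subst refl, subst integral_distr) auto
  also have "\<dots> = - integral\<^sup>L lborel h" by (simp add: odd)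
  finally have "2 *\<^sub>R integral\<^sup>L lborel h = 0"
    by (simp add: scaleR_2 eq_neg_iff_add_eq_0)
  with h show ?thesis by (simp add: has_bochner_integral_iff)
qed

lemma positive_not_nonpos_Int: "0 < x \<Longrightarrow> x \<notin> \<int>\<^sub>\<le>\<^sub>0" for x :: real
  by (auto dest: nonpos_Ints_nonpos)

text \<open>After division by r this is Bernoulli's inequality for p / r. It comes from Young's
  inequality with exponents q and q / (q - 1) and second factor 1.\<close>

lemma powr_ge_tangent:
  fixes p r q :: real
  assumes p: "0 \<le> p" and r: "0 < r" and q: "1 < q"
  shows "r + q * (p - r) \<le> p powr q * r powr (1 - q)"
proof -
  define t where "t = q / (q - 1)"
  have t: "1 < t" "1 / q + 1 / t = 1" "1 / t = 1 - 1 / q" using q by (auto simp: t_def field_simps)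
  have "p / r \<le> (p / r) powr q / q + (1 - 1 / q)"
    using Youngs_inequality[OF q t(1,2), of "p / r" 1] p r t(3) by simp
  hence "q * (p / r) \<le> q * ((p / r) powr q / q + (1 - 1 / q))"
    using q by (intro mult_left_mono) auto
  hence "1 + q * (p / r - 1) \<le> (p / r) powr q" using q by (simp add: algebra_simps)
  hence "r * (1 + q * (p / r - 1)) \<le> r * (p / r) powr q" using r by (intro mult_left_mono) auto
  also have "r * (p / r) powr q = p powr q * r powr (1 - q)"
    using p r by (simp add: powr_divide powr_diff)
  finally show ?thesis using r by (simp add: algebra_simps)
qed

lemma Z0_pos: "0 < \<nu> \<Longrightarrow> 0 < Z0 \<nu> n"
  by (simp add: Z0_def add_pos_nonneg)

text \<open>The choice of q makes \<open>(\<nu> + d) / 2 * (q - 1) = 1\<close> for the dimension d,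
  so the power 1 - q turns the Student kernel into a quadratic polynomial.\<close>

lemma prior_powr:
  fixes w :: "real ^ 'd"
  assumes "0 < \<nu>" and "q = 1 + 2 / (\<nu> + real CARD('d))"
  shows "prior \<nu> w powr (1 - q)
    = Z0 \<nu> CARD('d) powr (2 / (\<nu> + real CARD('d))) * (1 + (norm w)\<^sup>2 / \<nu>)"
proof -
  let ?s = "(\<nu> + real CARD('d)) / 2" and ?Z = "Z0 \<nu> CARD('d)" and ?X = "1 + (norm w)\<^sup>2 / \<nu>"
  have "0 < \<nu> + real CARD('d)" and X: "0 < ?X"
    using assms(1) by (auto intro: add_pos_nonneg)
  hence s: "- ?s * (1 - q) = 1"
    unfolding assms(2) by (simp add: field_simps)
  have Z: "0 < ?Z" by (rule Z0_pos[OF assms(1)])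
  have "prior \<nu> w powr (1 - q) = (1 / ?Z) powr (1 - q) * (?X powr (- ?s)) powr (1 - q)"
    using Z by (simp add: prior_def powr_mult powr_divide)
  also have "(?X powr (- ?s)) powr (1 - q) = ?X"
    using X by (simp only: powr_powr s powr_one less_imp_le)
  also have "(1 / ?Z) powr (1 - q) = ?Z powr (2 / (\<nu> + real CARD('d)))"
    using Z by (simp add: powr_divide powr_minus_divide assms(2))
  finally show ?thesis .
qed

section \<open>A single posterior: normalization and powers\<close>

locale student_posterior =
  fixes \<nu> q :: real and \<mu> :: "real ^ 'd"
  assumes \<nu>: "0 < \<nu>" and q: "q = 1 + 2 / (\<nu> + real CARD('d))"
    and scale: "0 < post_scale \<nu> \<mu>"
begin

definition kernel :: "real ^ 'd \<Rightarrow> real" where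
  "kernel w = 1 + (norm (w - \<mu>))\<^sup>2 / (\<nu> * post_scale \<nu> \<mu>)"

text \<open>The posterior's normalizing constant to the power 1 - q. It is also the integral of
  \<open>posterior \<nu> \<mu> w powr q * kernel w\<close>, by
  \<open>escort_kernel_integral\<close>.\<close>

definition escort_const :: real where
  "escort_const = (Z0 \<nu> CARD('d) * post_scale \<nu> \<mu> powr (real CARD('d) / 2))
    powr (- (2 / (\<nu> + real CARD('d))))"

text \<open>The unnormalized mean of the escort distribution, whose density is proportional to the
  q-th power of the posterior. The factor of \<mu> is the total mass of that power, see
  \<open>escort_mass\<close>.\<close>

definition escort_mean :: "real ^ 'd" where
  "escort_mean = (escort_const * \<nu> / (\<nu> + real CARD('d))) *\<^sub>R \<mu>"

lemma nd_pos: "0 < \<nu> + real CARD('d)"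
  using \<nu> by (simp add: add_pos_nonneg)

lemma Gamma_nonzero: "Gamma ((\<nu> + real CARD('d)) / 2) \<noteq> 0" "Gamma (\<nu> / 2) \<noteq> 0"
  using Gamma_real_pos[of "(\<nu> + real CARD('d)) / 2"] Gamma_real_pos[of "\<nu> / 2"] nd_pos \<nu>
  by (metis half_gt_zero less_irrefl)+

lemma q_gt_1: "1 < q"
  using nd_pos by (simp add: q)

lemma kernel_pos: "0 < kernel w"
  using \<nu> scale by (simp add: kernel_def add_pos_nonneg)

lemma kernel_measurable [measurable]: "kernel \<in> borel_measurable borel"
  unfolding kernel_def[abs_def] by measurable

lemma posterior_measurable [measurable]: "posterior \<nu> \<mu> \<in> borel_measurable borel"
  unfolding posterior_def[abs_def] by measurable

lemma posterior_eq: "posterior \<nu> \<mu> w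
    = 1 / (Z0 \<nu> CARD('d) * post_scale \<nu> \<mu> powr (real CARD('d) / 2))
      * kernel w powr (- ((\<nu> + real CARD('d)) / 2))"
  by (simp add: posterior_def kernel_def)

lemma posterior_pos: "0 < posterior \<nu> \<mu> w"
  using kernel_pos[of w] scale Z0_pos[OF \<nu>, of "CARD('d)"] by (simp add: posterior_eq)

lemma posterior_integral: "has_bochner_integral lborel (posterior \<nu> \<mu>) 1"
proof -
  have "has_bochner_integral lborel (\<lambda>w. 1 / (Z0 \<nu> CARD('d) * post_scale \<nu> \<mu> powr (real CARD('d) / 2))
      * kernel w powr (- ((\<nu> + real CARD('d)) / 2)))
    (1 / (Z0 \<nu> CARD('d) * post_scale \<nu> \<mu> powr (real CARD('d) / 2)) *
      ((\<nu> * post_scale \<nu> \<mu> * pi) powr (real DIM(real ^ 'd) / 2) *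
       Gamma ((\<nu> + real CARD('d)) / 2 - real DIM(real ^ 'd) / 2) / Gamma ((\<nu> + real CARD('d)) / 2)))"
    unfolding kernel_def using \<nu> scale
    by (intro has_bochner_integral_mult_right has_bochner_integral_student_kernel) auto
  moreover have "(\<nu> + real CARD('d)) / 2 - real DIM(real ^ 'd) / 2 = \<nu> / 2" by (simp add: field_simps)
  moreover have "1 / (Z0 \<nu> CARD('d) * post_scale \<nu> \<mu> powr (real CARD('d) / 2)) *
      ((\<nu> * post_scale \<nu> \<mu> * pi) powr (real DIM(real ^ 'd) / 2) *
       Gamma (\<nu> / 2) / Gamma ((\<nu> + real CARD('d)) / 2)) = 1"
    using \<nu> scale by (simp add: Z0_def powr_mult Gamma_nonzero)
  ultimately show ?thesis
    unfolding posterior_eq[abs_def] by (simp only:)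
qed

text \<open>Exponents cancel as in \<open>prior_powr\<close>, and \<open>escort_const\<close>
  removes the power of the normalizer.\<close>

lemma posterior_powr: "posterior \<nu> \<mu> w powr (1 - q) * escort_const = kernel w"
proof -
  let ?s = "(\<nu> + real CARD('d)) / 2"
  define Z where "Z = Z0 \<nu> CARD('d) * post_scale \<nu> \<mu> powr (real CARD('d) / 2)"
  have Z: "0 < Z" using scale Z0_pos[OF \<nu>, of "CARD('d)"] by (simp add: Z_def)
  have s: "- ?s * (1 - q) = 1" unfolding q using nd_pos by (simp add: field_simps)
  have "posterior \<nu> \<mu> w powr (1 - q) = (1 / Z) powr (1 - q) * (kernel w powr (- ?s)) powr (1 - q)"
    unfolding posterior_eq Z_def[symmetric] using Z by (simp add: powr_mult powr_divide)
  also have "(kernel w powr (- ?s)) powr (1 - q) = kernel w"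
    using kernel_pos[of w] by (simp only: powr_powr s powr_one less_imp_le)
  finally show ?thesis
    unfolding escort_const_def Z_def[symmetric] using Z
    by (simp add: powr_divide powr_minus_divide q)
qed

section \<open>Moments of the q-th power of the posterior\<close>

lemma escort_const_pos: "0 < escort_const"
  using scale Z0_pos[OF \<nu>, of "CARD('d)"] by (simp add: escort_const_def)

text \<open>The exponents q and 1 - q add up to 1, so integrating the q-th power against
  \<open>kernel\<close> needs only the normalization of the posterior.\<close>

lemma escort_eq: "posterior \<nu> \<mu> w powr q * kernel w = escort_const * posterior \<nu> \<mu> w"
  unfolding posterior_powr[symmetric] using posterior_pos[of w]
  by (simp add: powr_add[symmetric] mult.assoc[symmetric])

lemma escort_kernel_integral:
  "has_bochner_integral lborel (\<lambda>w. posterior \<nu> \<mu> w powr q * kernel w) escort_const"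
  using has_bochner_integral_mult_right[OF posterior_integral, of escort_const]
  by (simp add: escort_eq)

text \<open>By \<open>escort_eq\<close> the q-th power is again a Student kernel, with exponent
  larger by one. The recurrence \<open>Gamma (x + 1) = x * Gamma x\<close> reduces the new constant
  to the old one times \<open>\<nu> / (\<nu> + d)\<close>.\<close>

lemma escort_mass:
  "has_bochner_integral lborel (\<lambda>w. posterior \<nu> \<mu> w powr q) (escort_const * \<nu> / (\<nu> + real CARD('d)))"
proof -
  let ?s = "(\<nu> + real CARD('d)) / 2"
  let ?Z = "Z0 \<nu> CARD('d) * post_scale \<nu> \<mu> powr (real CARD('d) / 2)"
  have Z: "0 < ?Z" using scale Z0_pos[OF \<nu>, of "CARD('d)"] by simp
  have "posterior \<nu> \<mu> w powr q = escort_const / ?Z * kernel w powr (- (?s + 1))" for w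
  proof -
    have "posterior \<nu> \<mu> w powr q = escort_const * posterior \<nu> \<mu> w / kernel w"
      using kernel_pos[of w] by (simp add: escort_eq[symmetric])
    also have "\<dots> = escort_const / ?Z * (kernel w powr (- ?s) / kernel w)"
      by (simp add: posterior_eq)
    also have "kernel w powr (- ?s) / kernel w = kernel w powr (- ?s - 1)"
      using kernel_pos[of w] by (simp only: powr_diff powr_one less_imp_le)
    finally show ?thesis by simp
  qed
  moreover have "has_bochner_integral lborel (\<lambda>w. escort_const / ?Z * kernel w powr (- (?s + 1)))
    (escort_const / ?Z *
      ((\<nu> * post_scale \<nu> \<mu> * pi) powr (real DIM(real ^ 'd) / 2) *
       Gamma (?s + 1 - real DIM(real ^ 'd) / 2) / Gamma (?s + 1)))"
    unfolding kernel_def using \<nu> scale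
    by (intro has_bochner_integral_mult_right has_bochner_integral_student_kernel) (auto simp: field_simps)
  moreover have "?s + 1 - real DIM(real ^ 'd) / 2 = \<nu> / 2 + 1" by (simp add: field_simps)
  moreover have "escort_const / ?Z * ((\<nu> * post_scale \<nu> \<mu> * pi) powr (real DIM(real ^ 'd) / 2) *
       Gamma (\<nu> / 2 + 1) / Gamma (?s + 1)) = escort_const * \<nu> / (\<nu> + real CARD('d))"
  proof -
    have G: "Gamma (?s + 1) = ?s * Gamma ?s" "Gamma (\<nu> / 2 + 1) = \<nu> / 2 * Gamma (\<nu> / 2)"
      using nd_pos \<nu> by (intro Gamma_plus1 positive_not_nonpos_Int; simp)+
    show ?thesis unfolding G using \<nu> scale nd_pos by (simp add: Z0_def powr_mult Gamma_nonzero)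
  qed
  ultimately show ?thesis by (simp only:)
qed

text \<open>Supplies the integrable majorant for the first moment of the q-th power, for every
  positive \<nu>.\<close>

lemma norm_le_kernel: "norm (w - \<mu>) \<le> max 1 (\<nu> * post_scale \<nu> \<mu>) * kernel w"
proof -
  let ?k = "\<nu> * post_scale \<nu> \<mu>"
  have k: "0 < ?k" using \<nu> scale by simp
  have "norm (w - \<mu>) \<le> 1 + (norm (w - \<mu>))\<^sup>2"
    using zero_le_power2[of "norm (w - \<mu>) - 1"] zero_le_power2[of "norm (w - \<mu>)"]
      norm_ge_zero[of "w - \<mu>"]
    unfolding power2_diff by (simp del: norm_ge_zero)
  also have "\<dots> = 1 * 1 + ?k * ((norm (w - \<mu>))\<^sup>2 / ?k)" using \<nu> scale by simp
  also have "\<dots> \<le> max 1 ?k * 1 + max 1 ?k * ((norm (w - \<mu>))\<^sup>2 / ?k)"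
    using k by (intro add_mono mult_right_mono) auto
  finally show ?thesis by (simp add: kernel_def algebra_simps)
qed

text \<open>Split w into w - \<mu> and \<mu>: the first part is odd under reflection in \<mu> and
  integrates to 0, the second gives the mass times \<mu>.\<close>

lemma escort_mean_integral:
  "has_bochner_integral lborel (\<lambda>w. posterior \<nu> \<mu> w powr q *\<^sub>R w) escort_mean"
proof -
  have "integrable lborel (\<lambda>w. posterior \<nu> \<mu> w powr q *\<^sub>R (w - \<mu>))"
  proof (rule Bochner_Integration.integrable_bound)
    show "integrable lborel (\<lambda>w. max 1 (\<nu> * post_scale \<nu> \<mu>) * (posterior \<nu> \<mu> w powr q * kernel w))"
      using escort_kernel_integral by (simp add: has_bochner_integral_iff)
    show "AE w in lborel. norm (posterior \<nu> \<mu> w powr q *\<^sub>R (w - \<mu>))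
      \<le> norm (max 1 (\<nu> * post_scale \<nu> \<mu>) * (posterior \<nu> \<mu> w powr q * kernel w))"
    proof (rule AE_I2)
      fix w
      have "norm (posterior \<nu> \<mu> w powr q *\<^sub>R (w - \<mu>)) = posterior \<nu> \<mu> w powr q * norm (w - \<mu>)"
        by simp
      also have "\<dots> \<le> posterior \<nu> \<mu> w powr q * (max 1 (\<nu> * post_scale \<nu> \<mu>) * kernel w)"
        by (intro mult_left_mono norm_le_kernel) simp
      finally show "norm (posterior \<nu> \<mu> w powr q *\<^sub>R (w - \<mu>))
        \<le> norm (max 1 (\<nu> * post_scale \<nu> \<mu>) * (posterior \<nu> \<mu> w powr q * kernel w))"
        using kernel_pos[of w] by (simp add: mult.left_commute abs_mult)
    qed
  qed simp
  hence "has_bochner_integral lborel (\<lambda>w. posterior \<nu> \<mu> w powr q *\<^sub>R (w - \<mu>)) 0"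
    by (rule has_bochner_integral_reflect_odd[where \<mu> = \<mu>])
      (simp add: posterior_def norm_minus_commute scaleR_2 algebra_simps)
  from has_bochner_integral_add[OF this has_bochner_integral_scaleR_left[OF escort_mass, of \<mu>]]
  show ?thesis by (simp add: escort_mean_def algebra_simps)
qed

section \<open>The posterior as minimizer for its own escort mean\<close>

text \<open>Expanding the square leaves the constant
  \<open>post_scale \<nu> \<mu> + (norm \<mu>)\<^sup>2 / \<nu>\<close>, which is 1 by the choice of
  the scale. The linear term acts as the Lagrange term for the moment constraint.\<close>

lemma kernel_tilt:
  "post_scale \<nu> \<mu> * kernel w = (1 + (norm w)\<^sup>2 / \<nu>) - 2 / \<nu> * (\<mu> \<bullet> w)"
proof -
  have "post_scale \<nu> \<mu> * kernel w = post_scale \<nu> \<mu> + (norm (w - \<mu>))\<^sup>2 / \<nu>"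
    using scale \<nu> by (simp add: kernel_def field_simps)
  also have "(norm (w - \<mu>))\<^sup>2 = (norm w)\<^sup>2 - 2 * (\<mu> \<bullet> w) + (norm \<mu>)\<^sup>2"
    unfolding power2_norm_eq_inner by (simp add: inner_diff_left inner_diff_right inner_commute)
  finally show ?thesis using \<nu> by (simp add: post_scale_def field_simps)
qed

text \<open>Solve \<open>kernel_tilt\<close> for the quadratic polynomial and integrate against the
  q-th power.\<close>

lemma escort_second_moment:
  "has_bochner_integral lborel (\<lambda>w. posterior \<nu> \<mu> w powr q * (1 + (norm w)\<^sup>2 / \<nu>))
    (post_scale \<nu> \<mu> * escort_const + 2 / \<nu> * (\<mu> \<bullet> escort_mean))"
proof -
  have "has_bochner_integral lborel (\<lambda>w. post_scale \<nu> \<mu> * (posterior \<nu> \<mu> w powr q * kernel w)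
      + 2 / \<nu> * (\<mu> \<bullet> (posterior \<nu> \<mu> w powr q *\<^sub>R w)))
    (post_scale \<nu> \<mu> * escort_const + 2 / \<nu> * (\<mu> \<bullet> escort_mean))"
    by (intro has_bochner_integral_add has_bochner_integral_mult_right
        has_bochner_integral_inner_right escort_kernel_integral escort_mean_integral)
  moreover have "post_scale \<nu> \<mu> * (posterior \<nu> \<mu> w powr q * kernel w)
      + 2 / \<nu> * (\<mu> \<bullet> (posterior \<nu> \<mu> w powr q *\<^sub>R w)) = posterior \<nu> \<mu> w powr q * (1 + (norm w)\<^sup>2 / \<nu>)" for w
    by (simp only: mult.left_commute[of "post_scale \<nu> \<mu>"] kernel_tilt) (simp add: algebra_simps)
  ultimately show ?thesis by simp
qed

text \<open>By \<open>kernel_tilt\<close> the claim amounts to \<open>\<integral> p powr q * r powr (1 - q) \<ge> 1\<close> for the posterior \<open>r\<close>,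
  which is the tangent inequality for \<open>powr q\<close> at \<open>r\<close>, integrated.\<close>

lemma escort_second_moment_minimal:
  assumes p: "\<And>w. 0 \<le> p w" "has_bochner_integral lborel p 1"
    and T: "has_bochner_integral lborel (\<lambda>w. p w powr q * (1 + (norm w)\<^sup>2 / \<nu>)) T"
    and m: "has_bochner_integral lborel (\<lambda>w. p w powr q *\<^sub>R w) escort_mean"
  shows "post_scale \<nu> \<mu> * escort_const + 2 / \<nu> * (\<mu> \<bullet> escort_mean) \<le> T"
proof -
  have tilt: "p w powr q * (1 + (norm w)\<^sup>2 / \<nu>) - 2 / \<nu> * (\<mu> \<bullet> (p w powr q *\<^sub>R w))
      = post_scale \<nu> \<mu> * (p w powr q * kernel w)" for w
    by (simp only: mult.left_commute[of "post_scale \<nu> \<mu>"] kernel_tilt) (simp add: algebra_simps)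
  \<comment> \<open>Since p has the same \<open>escort_mean\<close> as the posterior, the linear
    term contributes the same amount for both densities.\<close>
  have "has_bochner_integral lborel (\<lambda>w. post_scale \<nu> \<mu> * (p w powr q * kernel w))
      (T - 2 / \<nu> * (\<mu> \<bullet> escort_mean))"
    unfolding tilt[symmetric]
    by (intro has_bochner_integral_diff has_bochner_integral_mult_right
        has_bochner_integral_inner_right T m)
  \<comment> \<open>The tangent's slope term integrates to 0 because both densities have mass
    1.\<close>
  moreover have "has_bochner_integral lborel (\<lambda>w. post_scale \<nu> \<mu> * (escort_const *
        (posterior \<nu> \<mu> w + q * (p w - posterior \<nu> \<mu> w))))
      (post_scale \<nu> \<mu> * (escort_const * (1 + q * (1 - 1))))"
    by (intro has_bochner_integral_add has_bochner_integral_mult_right has_bochner_integral_diff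
        p posterior_integral)
  moreover have "post_scale \<nu> \<mu> * (escort_const * (posterior \<nu> \<mu> w + q * (p w - posterior \<nu> \<mu> w)))
      \<le> post_scale \<nu> \<mu> * (p w powr q * kernel w)" for w
  proof -
    have "escort_const * (posterior \<nu> \<mu> w + q * (p w - posterior \<nu> \<mu> w))
      \<le> escort_const * (p w powr q * posterior \<nu> \<mu> w powr (1 - q))"
      by (intro mult_left_mono powr_ge_tangent p posterior_pos q_gt_1 less_imp_le[OF escort_const_pos])
    also have "\<dots> = p w powr q * kernel w"
      by (simp add: posterior_powr[symmetric])
    finally show ?thesis using scale by (intro mult_left_mono) auto
  qed
  ultimately have "post_scale \<nu> \<mu> * (escort_const * (1 + q * (1 - 1))) \<le> T - 2 / \<nu> * (\<mu> \<bullet> escort_mean)"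
    unfolding has_bochner_integral_iff by (metis (lifting) integral_mono)
  thus ?thesis by simp
qed

section \<open>The expectation of the posterior\<close>

text \<open>A sharper bound than \<open>norm_le_kernel\<close>: it costs only half a power of
  \<open>kernel\<close>, as the posterior itself decays more slowly than its q-th power.\<close>

lemma norm_le_sqrt_kernel:
  "norm (w - \<mu>) \<le> sqrt (\<nu> * post_scale \<nu> \<mu>) * kernel w powr (1/2)"
proof -
  have "(norm (w - \<mu>))\<^sup>2 \<le> \<nu> * post_scale \<nu> \<mu> * kernel w"
    using \<nu> scale by (simp add: kernel_def field_simps)
  from real_le_rsqrt[OF this] show ?thesis
    using kernel_pos[of w] by (simp add: powr_half_sqrt real_sqrt_mult)
qed

lemma integrable_posterior_mean:
  assumes "1 < \<nu>"
  shows "integrable lborel (\<lambda>w. posterior \<nu> \<mu> w *\<^sub>R w)"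
proof -
  let ?s = "(\<nu> + real CARD('d)) / 2"
  let ?B = "1 / (Z0 \<nu> CARD('d) * post_scale \<nu> \<mu> powr (real CARD('d) / 2))"
  let ?r = "sqrt (\<nu> * post_scale \<nu> \<mu>)"
  have "integrable lborel (\<lambda>w. posterior \<nu> \<mu> w *\<^sub>R (w - \<mu>))"
  proof (rule Bochner_Integration.integrable_bound)
    \<comment> \<open>The exponent exceeds half the dimension exactly when
      \<open>1 < \<nu>\<close>.\<close>
    have "integrable lborel (\<lambda>w. kernel w powr (- (?s - 1/2)))"
      unfolding kernel_def using \<nu> scale assms
      by (intro integrable.intros[OF has_bochner_integral_student_kernel]) (auto simp: field_simps)
    thus "integrable lborel (\<lambda>w. ?B * ?r * kernel w powr (- (?s - 1/2)))" by simp
    show "AE w in lborel. norm (posterior \<nu> \<mu> w *\<^sub>R (w - \<mu>)) \<le> norm (?B * ?r * kernel w powr (- (?s - 1/2)))"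
    proof (rule AE_I2)
      fix w
      have "norm (posterior \<nu> \<mu> w *\<^sub>R (w - \<mu>)) = posterior \<nu> \<mu> w * norm (w - \<mu>)"
        using posterior_pos[of w] by simp
      also have "\<dots> \<le> posterior \<nu> \<mu> w * (?r * kernel w powr (1/2))"
        using posterior_pos[of w] by (intro mult_left_mono norm_le_sqrt_kernel) simp
      also have "\<dots> = ?B * ?r * (kernel w powr (- ?s) * kernel w powr (1/2))"
        by (simp add: posterior_eq)
      also have "kernel w powr (- ?s) * kernel w powr (1/2) = kernel w powr (- (?s - 1/2))"
        by (simp only: powr_add[symmetric]) simp
      finally show "norm (posterior \<nu> \<mu> w *\<^sub>R (w - \<mu>)) \<le> norm (?B * ?r * kernel w powr (- (?s - 1/2)))"
        unfolding real_norm_def by (rule order_trans[OF _ abs_ge_self])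
    qed
  qed simp
  moreover have "integrable lborel (\<lambda>w. posterior \<nu> \<mu> w *\<^sub>R \<mu>)"
    using posterior_integral by (intro integrable_scaleR_left) (simp add: has_bochner_integral_iff)
  ultimately have "integrable lborel (\<lambda>w. posterior \<nu> \<mu> w *\<^sub>R (w - \<mu>) + posterior \<nu> \<mu> w *\<^sub>R \<mu>)"
    by (rule Bochner_Integration.integrable_add)
  thus ?thesis by (simp add: algebra_simps)
qed

text \<open>The same reflection argument as in \<open>escort_mean_integral\<close>, now with mass 1.
  Integrability is assumed because the Bochner integral defaults to 0 without it.\<close>

lemma posterior_mean:
  assumes "integrable lborel (\<lambda>w. posterior \<nu> \<mu> w *\<^sub>R w)"
  shows "(\<integral>w. posterior \<nu> \<mu> w *\<^sub>R w \<partial>lborel) = \<mu>"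
proof -
  have c: "has_bochner_integral lborel (\<lambda>w. posterior \<nu> \<mu> w *\<^sub>R \<mu>) (1 *\<^sub>R \<mu>)"
    by (rule has_bochner_integral_scaleR_left[OF posterior_integral])
  have "integrable lborel (\<lambda>w. posterior \<nu> \<mu> w *\<^sub>R w - posterior \<nu> \<mu> w *\<^sub>R \<mu>)"
    using assms c by (intro Bochner_Integration.integrable_diff) (auto simp: has_bochner_integral_iff)
  hence "has_bochner_integral lborel (\<lambda>w. posterior \<nu> \<mu> w *\<^sub>R w - posterior \<nu> \<mu> w *\<^sub>R \<mu>) 0"
    by (rule has_bochner_integral_reflect_odd[where \<mu> = \<mu>])
      (simp add: posterior_def norm_minus_commute scaleR_2 algebra_simps)
  from has_bochner_integral_add[OF this c] show ?thesis
    by (simp add: has_bochner_integral_iff)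
qed

section \<open>Closed forms and the reduced problem\<close>

lemma escort_const_eq: "escort_const = Z0 \<nu> CARD('d) powr (- (2 / (\<nu> + real CARD('d))))
    * post_scale \<nu> \<mu> powr (- (real CARD('d) / (\<nu> + real CARD('d))))"
  using Z0_pos[OF \<nu>, of "CARD('d)"] scale nd_pos
  by (simp add: escort_const_def powr_mult powr_powr)

text \<open>The normalizers of prior and posterior cancel, which is why no Gamma factor survives in
  \<open>red_objective\<close>.\<close>

lemma Z0_escort_const: "Z0 \<nu> CARD('d) powr (2 / (\<nu> + real CARD('d))) * escort_const
    = post_scale \<nu> \<mu> powr (- (real CARD('d) / (\<nu> + real CARD('d))))"
  using Z0_pos[OF \<nu>, of "CARD('d)"] by (simp add: escort_const_eq powr_minus)

text \<open>Identifies the explicit factor in \<open>red_feasible\<close> as the mass of the q-th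
  power. The power \<open>- d / (\<nu> + d)\<close> of \<nu> from \<open>Z0\<close> merges with the
  extra factor \<nu>.\<close>

lemma escort_coefficient:
  "escort_const * \<nu> / (\<nu> + real CARD('d))
    = \<nu> powr (\<nu> / (\<nu> + real CARD('d))) * pi powr (- (real CARD('d) / (\<nu> + real CARD('d))))
          / (\<nu> + real CARD('d))
        * (Gamma ((\<nu> + real CARD('d)) / 2) / Gamma (\<nu> / 2)) powr (2 / (\<nu> + real CARD('d)))
        * (1 - 1 / \<nu> * (norm \<mu>)\<^sup>2) powr (- (real CARD('d) / (\<nu> + real CARD('d))))"
proof -
  let ?n = "\<nu> + real CARD('d)"
  define G1 where "G1 = Gamma (?n / 2)"
  define G2 where "G2 = Gamma (\<nu> / 2)"
  have G: "0 < G1" "0 < G2" using nd_pos \<nu> by (simp_all add: G1_def G2_def)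
  have "Z0 \<nu> CARD('d) powr (- (2 / ?n))
      = (G1 / G2) powr (2 / ?n) * \<nu> powr (- (real CARD('d) / ?n)) * pi powr (- (real CARD('d) / ?n))"
    unfolding Z0_def G1_def[symmetric] G2_def[symmetric] using G \<nu>
    by (simp add: powr_mult powr_divide powr_powr powr_minus field_simps)
  moreover have "\<nu> powr (\<nu> / ?n) = \<nu> powr (- (real CARD('d) / ?n)) * \<nu>"
  proof -
    have "\<nu> / ?n = - (real CARD('d) / ?n) + 1" using nd_pos by (simp add: field_simps)
    thus ?thesis using \<nu> by (simp only: powr_add powr_one less_imp_le)
  qed
  ultimately show ?thesis
    unfolding escort_const_eq by (simp add: G1_def G2_def post_scale_def)
qed

text \<open>The right-hand side is shared with \<open>posterior_feasible_iff\<close>; chaining the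
  two identifies feasibility in both problems.\<close>

lemma red_feasible_iff:
  "red_feasible \<nu> y f (\<mu>, z) \<longleftrightarrow> (\<forall>i. z $ i = y i * (f i \<bullet> escort_mean))"
proof -
  have "a * (y i * (f i \<bullet> \<mu>)) = y i * (f i \<bullet> a *\<^sub>R \<mu>)" for a i by simp
  thus ?thesis
    using scale unfolding red_feasible_def prod.case escort_mean_def escort_coefficient[symmetric]
    by (simp only: post_scale_def) simp
qed

lemma prior_powr_posterior:
  "has_bochner_integral lborel (\<lambda>w. posterior \<nu> \<mu> w powr q * prior \<nu> w powr (1 - q))
    (Z0 \<nu> CARD('d) powr (2 / (\<nu> + real CARD('d))) *
      (post_scale \<nu> \<mu> * escort_const + 2 / \<nu> * (\<mu> \<bullet> escort_mean)))"
  using has_bochner_integral_mult_right[OF escort_second_moment,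
      of "Z0 \<nu> CARD('d) powr (2 / (\<nu> + real CARD('d)))"]
  by (simp add: prior_powr[OF \<nu> q] mult.left_commute)

lemma posterior_feasible_iff:
  "med_feasible q (prior \<nu>) y f (posterior \<nu> \<mu>, z) \<longleftrightarrow> (\<forall>i. z $ i = y i * (f i \<bullet> escort_mean))"
proof -
  have "has_bochner_integral lborel (\<lambda>w. y i * (f i \<bullet> w) * posterior \<nu> \<mu> w powr q)
      (y i * (f i \<bullet> escort_mean))" for i
    using has_bochner_integral_mult_right[OF has_bochner_integral_inner_right[OF escort_mean_integral, of "f i"], of "y i"]
    by (simp add: mult_ac)
  thus ?thesis
    unfolding med_feasible_def
    using posterior_pos posterior_integral prior_powr_posterior
    by (auto simp: less_imp_le has_bochner_integral_iff)
qed

lemma posterior_objective: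
  "med_objective q (prior \<nu>) C q' (posterior \<nu> \<mu>, z) = red_objective \<nu> C q' (\<mu>, z)"
proof -
  let ?n = "\<nu> + real CARD('d)"
  let ?P = "post_scale \<nu> \<mu> powr (- (real CARD('d) / ?n))"
  \<comment> \<open>Here \<open>2 / \<nu> * (\<mu> \<bullet> escort_mean)\<close> is
    \<open>escort_const\<close> times \<open>2 * (norm \<mu>)\<^sup>2 / ?n\<close>, so
    \<open>escort_const\<close> factors out.\<close>
  have "(\<integral>w. posterior \<nu> \<mu> w powr q * prior \<nu> w powr (1 - q) \<partial>lborel)
    = (Z0 \<nu> CARD('d) powr (2 / ?n) * escort_const) * (post_scale \<nu> \<mu> + 2 * (norm \<mu>)\<^sup>2 / ?n)"
    using prior_powr_posterior \<nu>
    by (simp add: has_bochner_integral_iff escort_mean_def power2_norm_eq_inner algebra_simps)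
  also have "\<dots> = ?P * (1 - 1 / \<nu> * (norm \<mu>)\<^sup>2 + 2 * (norm \<mu>)\<^sup>2 / ?n)"
    unfolding Z0_escort_const by (simp add: post_scale_def)
  also have "1 - 1 / \<nu> * (norm \<mu>)\<^sup>2 + 2 * (norm \<mu>)\<^sup>2 / ?n
      = ((\<nu> - real CARD('d)) / \<nu> * (norm \<mu>)\<^sup>2 + \<nu> + real CARD('d)) / ?n"
    using \<nu> nd_pos by (simp add: field_simps)
  finally have "tsallis_divergence q (posterior \<nu> \<mu>) (prior \<nu>)
      = (?P * (((\<nu> - real CARD('d)) / \<nu> * (norm \<mu>)\<^sup>2 + \<nu> + real CARD('d)) / ?n) - 1) / (2 / ?n)"
    by (simp add: tsallis_divergence_def q)
  also have "\<dots> = 1 / 2 * ?P * ((\<nu> - real CARD('d)) / \<nu> * (norm \<mu>)\<^sup>2 + \<nu> + real CARD('d)) - ?n / 2"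
  proof -
    have "(a * (b / n) - 1) / (2 / n) = 1 / 2 * a * b - n / 2" if "n \<noteq> 0" for a b n :: real
      using that by (simp add: field_simps)
    thus ?thesis using nd_pos by (metis less_irrefl)
  qed
  finally show ?thesis by (simp add: med_objective_def red_objective_def post_scale_def)
qed

end

section \<open>Domination of arbitrary densities by posteriors\<close>

text \<open>As \<open>escort_mean\<close> is a positive multiple of \<mu>, a nonzero v is reached
  along its own ray, and only the length t of \<mu> remains to be found.\<close>

lemma escort_mean_surj:
  fixes v :: "real ^ 'd"
  assumes \<nu>: "0 < \<nu>"
  obtains \<mu> where "0 < post_scale \<nu> \<mu>" "student_posterior.escort_mean \<nu> \<mu> = v"
proof (cases "v = 0")
  case True
  interpret student_posterior \<nu> "1 + 2 / (\<nu> + real CARD('d))" "0 :: real ^ 'd"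
    using \<nu> by unfold_locales (auto simp: post_scale_def)
  show ?thesis by (rule that[OF scale]) (simp add: escort_mean_def True)
next
  case False
  \<comment> \<open>The constants for which \<open>escort_mean\<close> has norm
    \<open>K * t * (1 - t\<^sup>2 / \<nu>) powr (- e)\<close> when \<mu> has norm t.\<close>
  define e where "e = real CARD('d) / (\<nu> + real CARD('d))"
  define K where "K = Z0 \<nu> CARD('d) powr (- (2 / (\<nu> + real CARD('d)))) * \<nu> / (\<nu> + real CARD('d))"
  have n: "0 < \<nu> + real CARD('d)" using \<nu> by (simp add: add_pos_nonneg)
  have e: "0 < e" using n by (simp add: e_def)
  have K: "0 < K" using n \<nu> Z0_pos[OF \<nu>, of "CARD('d)"] by (simp add: K_def)
  define F where "F t = K * t - norm v * (1 - t\<^sup>2 / \<nu>) powr e" for t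
  \<comment> \<open>\<open>F t = 0\<close> is \<open>K * t * (1 - t\<^sup>2 / \<nu>) powr (- e) = norm v\<close> cleared of the factor that blows up at
    \<open>sqrt \<nu>\<close>, so that the intermediate value theorem applies on the closed interval.\<close>
  have "\<exists>t\<ge>0. t \<le> sqrt \<nu> \<and> F t = 0"
  proof (rule IVT')
    show "F 0 \<le> 0" "0 \<le> F (sqrt \<nu>)" "0 \<le> sqrt \<nu>" using K \<nu> e by (auto simp: F_def)
    have "t\<^sup>2 \<le> \<nu>" if "t \<in> {0..sqrt \<nu>}" for t
      using that \<nu> real_sqrt_pow2[of \<nu>] power_mono[of t "sqrt \<nu>" 2] by simp
    thus "continuous_on {0..sqrt \<nu>} F"
      unfolding F_def[abs_def] using e \<nu>
      by (intro continuous_intros continuous_on_powr') auto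
  qed
  then obtain t where t: "0 \<le> t" "t \<le> sqrt \<nu>" "F t = 0" by blast
  \<comment> \<open>At the endpoint \<open>0 powr e = 0\<close>, so F is positive there; the root
    lies strictly inside and the scale is positive.\<close>
  have "t \<noteq> sqrt \<nu>" using t(3) K \<nu> e by (auto simp: F_def)
  with t have "t\<^sup>2 < (sqrt \<nu>)\<^sup>2" by (intro power_strict_mono) auto
  hence t2: "0 < 1 - t\<^sup>2 / \<nu>" using \<nu> by simp
  define \<mu> where "\<mu> = (t / norm v) *\<^sub>R v"
  have nm: "norm \<mu> = t" using False t(1) by (simp add: \<mu>_def)
  interpret student_posterior \<nu> "1 + 2 / (\<nu> + real CARD('d))" \<mu>
    using \<nu> t2 by unfold_locales (auto simp: post_scale_def nm)
  have "escort_mean = (K * t * (1 - t\<^sup>2 / \<nu>) powr (- e) / norm v) *\<^sub>R v"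
    by (simp add: escort_mean_def escort_const_eq post_scale_def nm K_def e_def) (simp add: \<mu>_def)
  also have "K * t = norm v * (1 - t\<^sup>2 / \<nu>) powr e" using t(3) by (simp add: F_def)
  finally have "escort_mean = (norm v * ((1 - t\<^sup>2 / \<nu>) powr e * (1 - t\<^sup>2 / \<nu>) powr (- e)) / norm v) *\<^sub>R v"
    by (simp only: mult.assoc)
  moreover have "a powr e * a powr (- e) = 1" if "0 < a" for a :: real
    using that by (simp add: powr_minus)
  ultimately have "escort_mean = v" using False t2 by simp
  with scale show ?thesis by (rule that)
qed

text \<open>The constraints control only the projections onto the \<open>f i\<close>. Integrability
  of the divergence integrand controls the second moment of the q-th power, and hence the whole
  vector m.\<close>

lemma med_feasible_moments:
  fixes p :: "real ^ 'd \<Rightarrow> real"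
  assumes \<nu>: "0 < \<nu>" and q: "q = 1 + 2 / (\<nu> + real CARD('d))"
    and feas: "med_feasible q (prior \<nu>) y f (p, z)"
  obtains T m where
    "has_bochner_integral lborel (\<lambda>w. p w powr q * (1 + (norm w)\<^sup>2 / \<nu>)) T"
    "has_bochner_integral lborel (\<lambda>w. p w powr q *\<^sub>R w) m"
    "\<And>i. z $ i = y i * (f i \<bullet> m)"
proof -
  let ?Z = "Z0 \<nu> CARD('d) powr (2 / (\<nu> + real CARD('d)))"
  have Z: "0 < ?Z" using Z0_pos[OF \<nu>, of "CARD('d)"] by simp
  have [measurable]: "p \<in> borel_measurable borel"
    using feas by (auto simp: med_feasible_def has_bochner_integral_iff dest: borel_measurable_integrable)
  have "integrable lborel (\<lambda>w. p w powr q * prior \<nu> w powr (1 - q))"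
    using feas by (simp add: med_feasible_def)
  hence "integrable lborel (\<lambda>w. inverse ?Z * (p w powr q * prior \<nu> w powr (1 - q)))"
    by (rule integrable_mult_right)
  moreover have "inverse ?Z * (p w powr q * prior \<nu> w powr (1 - q)) = p w powr q * (1 + (norm w)\<^sup>2 / \<nu>)" for w
    using Z by (simp add: prior_powr[OF \<nu> q])
  ultimately have T: "integrable lborel (\<lambda>w. p w powr q * (1 + (norm w)\<^sup>2 / \<nu>))"
    by simp
  have m: "integrable lborel (\<lambda>w. p w powr q *\<^sub>R w)"
  proof (rule Bochner_Integration.integrable_bound)
    show "integrable lborel (\<lambda>w. (1 + \<nu>) * (p w powr q * (1 + (norm w)\<^sup>2 / \<nu>)))"
      using T by simp
    show "AE w in lborel. norm (p w powr q *\<^sub>R w) \<le> norm ((1 + \<nu>) * (p w powr q * (1 + (norm w)\<^sup>2 / \<nu>)))"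
    proof (rule AE_I2)
      fix w :: "real ^ 'd"
      have "0 \<le> (norm w - 1)\<^sup>2" by simp
      hence "norm w \<le> 1 + (norm w)\<^sup>2" using norm_ge_zero[of w] unfolding power2_diff
        by (simp del: norm_ge_zero)
      also have "\<dots> \<le> 1 + (norm w)\<^sup>2 + (\<nu> + (norm w)\<^sup>2 / \<nu>)" using \<nu> by simp
      also have "\<dots> = (1 + \<nu>) * (1 + (norm w)\<^sup>2 / \<nu>)" using \<nu> by (simp add: field_simps)
      finally have "p w powr q * norm w \<le> p w powr q * ((1 + \<nu>) * (1 + (norm w)\<^sup>2 / \<nu>))"
        by (intro mult_left_mono) auto
      thus "norm (p w powr q *\<^sub>R w) \<le> norm ((1 + \<nu>) * (p w powr q * (1 + (norm w)\<^sup>2 / \<nu>)))"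
        using \<nu> by (simp add: mult.left_commute abs_mult add_nonneg_nonneg)
    qed
  qed simp
  let ?m = "integral\<^sup>L lborel (\<lambda>w. p w powr q *\<^sub>R w)"
  have hm: "has_bochner_integral lborel (\<lambda>w. p w powr q *\<^sub>R w) ?m"
    using m by (rule has_bochner_integral_integrable)
  have "z $ i = y i * (f i \<bullet> ?m)" for i
  proof -
    have "has_bochner_integral lborel (\<lambda>w. y i * (f i \<bullet> w) * p w powr q) (y i * (f i \<bullet> ?m))"
      using has_bochner_integral_mult_right[OF has_bochner_integral_inner_right[OF hm, of "f i"], of "y i"]
      by (simp add: mult_ac)
    moreover have "has_bochner_integral lborel (\<lambda>w. y i * (f i \<bullet> w) * p w powr q) (z $ i)"
      using feas by (simp add: med_feasible_def)
    ultimately show ?thesis by (blast intro: has_bochner_integral_eq)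
  qed
  with has_bochner_integral_integrable[OF T] hm show ?thesis by (rule that)
qed

text \<open>Take \<mu> with the same moment vector m as p. Then z and the loss are unchanged, and
  the divergence does not increase by \<open>escort_second_moment_minimal\<close>.\<close>

lemma posterior_dominates:
  fixes p :: "real ^ 'd \<Rightarrow> real"
  assumes \<nu>: "0 < \<nu>" and q: "q = 1 + 2 / (\<nu> + real CARD('d))"
    and feas: "med_feasible q (prior \<nu>) y f (p, z)"
  obtains \<mu> where "0 < post_scale \<nu> \<mu>" "med_feasible q (prior \<nu>) y f (posterior \<nu> \<mu>, z)"
    "med_objective q (prior \<nu>) C q' (posterior \<nu> \<mu>, z) \<le> med_objective q (prior \<nu>) C q' (p, z)"
proof -
  obtain T m where T: "has_bochner_integral lborel (\<lambda>w. p w powr q * (1 + (norm w)\<^sup>2 / \<nu>)) T"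
    and m: "has_bochner_integral lborel (\<lambda>w. p w powr q *\<^sub>R w) m"
    and z: "\<And>i. z $ i = y i * (f i \<bullet> m)"
    using med_feasible_moments[OF assms] by blast
  obtain \<mu> where \<mu>: "0 < post_scale \<nu> \<mu>" "student_posterior.escort_mean \<nu> \<mu> = m"
    using escort_mean_surj[OF \<nu>] by blast
  interpret student_posterior \<nu> q \<mu> using \<nu> q \<mu> by unfold_locales
  let ?Z = "Z0 \<nu> CARD('d) powr (2 / (\<nu> + real CARD('d)))"
  have "(\<integral>w. p w powr q * prior \<nu> w powr (1 - q) \<partial>lborel) = ?Z * T"
    using has_bochner_integral_mult_right[OF T, of ?Z]
    by (simp add: prior_powr[OF \<nu> q] mult.left_commute has_bochner_integral_iff)
  moreover have "(\<integral>w. posterior \<nu> \<mu> w powr q * prior \<nu> w powr (1 - q) \<partial>lborel)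
      = ?Z * (post_scale \<nu> \<mu> * escort_const + 2 / \<nu> * (\<mu> \<bullet> escort_mean))"
    using prior_powr_posterior by (simp only: has_bochner_integral_iff)
  moreover have "post_scale \<nu> \<mu> * escort_const + 2 / \<nu> * (\<mu> \<bullet> escort_mean) \<le> T"
    using feas T m \<mu>(2) by (intro escort_second_moment_minimal) (auto simp: med_feasible_def)
  ultimately have "tsallis_divergence q (posterior \<nu> \<mu>) (prior \<nu>) \<le> tsallis_divergence q p (prior \<nu>)"
    using q_gt_1 unfolding tsallis_divergence_def
    by (simp add: divide_right_mono mult_left_mono)
  moreover have "med_feasible q (prior \<nu>) y f (posterior \<nu> \<mu>, z)"
    unfolding posterior_feasible_iff using z \<mu>(2) by simp
  ultimately show ?thesis using that[OF \<mu>(1)] by (simp add: med_objective_def)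
qed

section \<open>Transfer of minimizers between the problems\<close>

theorem theorem4:
  fixes \<nu> q q' C :: real
    and x :: "'m::finite \<Rightarrow> real ^ 'n" and y :: "'m \<Rightarrow> real"
    and \<phi> :: "'d::finite \<Rightarrow> real ^ 'n \<Rightarrow> real"
    and f :: "'m \<Rightarrow> real ^ 'd"
    and p0 :: "real ^ 'd \<Rightarrow> real"
  assumes "0 < \<nu>" and "0 \<le> q'" and "q' \<le> 1" and "0 < C"
    and "q = 1 + 2 / (\<nu> + real CARD('d))"
    and "\<And>i. y i \<in> {-1, 1}"
    and "\<And>i. f i = feature_vec \<phi> (x i)"
    and "p0 = prior \<nu>"
  shows "\<forall>\<mu> z. 0 < post_scale \<nu> \<mu> \<longrightarrow>
      (med_feasible q p0 y f (posterior \<nu> \<mu>, z) \<longleftrightarrow> red_feasible \<nu> y f (\<mu>, z)) \<and>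
      med_objective q p0 C q' (posterior \<nu> \<mu>, z) = red_objective \<nu> C q' (\<mu>, z) \<and>
      (is_arg_min (med_objective q p0 C q')
          (\<lambda>(p, z). p \<in> posterior_family \<nu> \<and> med_feasible q p0 y f (p, z)) (posterior \<nu> \<mu>, z)
        \<longleftrightarrow> is_arg_min (red_objective \<nu> C q') (red_feasible \<nu> y f) (\<mu>, z)) \<and>
      (is_arg_min (med_objective q p0 C q') (med_feasible q p0 y f) (posterior \<nu> \<mu>, z)
        \<longleftrightarrow> is_arg_min (red_objective \<nu> C q') (red_feasible \<nu> y f) (\<mu>, z)) \<and>
      (1 < \<nu> \<longrightarrow> integrable lborel (\<lambda>w. posterior \<nu> \<mu> w *\<^sub>R w)) \<and>
      (integrable lborel (\<lambda>w. posterior \<nu> \<mu> w *\<^sub>R w) \<longrightarrow>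
        (\<integral>w. posterior \<nu> \<mu> w *\<^sub>R w \<partial>lborel) = \<mu>)"
proof (intro allI impI)
  fix \<mu> :: "real ^ 'd" and z :: "real ^ 'm"
  assume \<mu>: "0 < post_scale \<nu> \<mu>"
  have loc: "student_posterior \<nu> q \<mu>'" if "0 < post_scale \<nu> \<mu>'" for \<mu>' :: "real ^ 'd"
    using assms that by unfold_locales
  interpret student_posterior \<nu> q \<mu> by (rule loc[OF \<mu>])
  let ?obj = "med_objective q p0 C q'" and ?feas = "med_feasible q p0 y f"
  let ?robj = "red_objective \<nu> C q'" and ?rfeas = "red_feasible \<nu> y f"
  let ?fam = "\<lambda>(p, z). p \<in> posterior_family \<nu> \<and> ?feas (p, z)"
  have feas: "?feas (posterior \<nu> \<mu>', z') \<longleftrightarrow> ?rfeas (\<mu>', z')" if "0 < post_scale \<nu> \<mu>'" for \<mu>' z'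
    unfolding \<open>p0 = prior \<nu>\<close>
    using student_posterior.posterior_feasible_iff[OF loc[OF that]]
      student_posterior.red_feasible_iff[OF loc[OF that]] by blast
  have obj: "?obj (posterior \<nu> \<mu>', z') = ?robj (\<mu>', z')" if "0 < post_scale \<nu> \<mu>'" for \<mu>' z'
    unfolding \<open>p0 = prior \<nu>\<close> by (rule student_posterior.posterior_objective[OF loc[OF that]])
  have rscale: "0 < post_scale \<nu> \<mu>'" if "?rfeas (\<mu>', z')" for \<mu>' z'
    using that by (simp add: red_feasible_def post_scale_def)
  have fam: "posterior \<nu> \<mu>' \<in> posterior_family \<nu>" if "0 < post_scale \<nu> \<mu>'" for \<mu>' :: "real ^ 'd"
    using that by (auto simp: posterior_family_def)
  have dom: "\<exists>\<mu>'. ?rfeas (\<mu>', z') \<and> ?robj (\<mu>', z') \<le> ?obj (p, z')" if p: "?feas (p, z')" for p z'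
  proof -
    obtain \<mu>' where \<mu>': "0 < post_scale \<nu> \<mu>'" "?feas (posterior \<nu> \<mu>', z')"
      "?obj (posterior \<nu> \<mu>', z') \<le> ?obj (p, z')"
      using posterior_dominates[OF assms(1,5) p[unfolded \<open>p0 = prior \<nu>\<close>], of C q']
      unfolding \<open>p0 = prior \<nu>\<close> by blast
    show ?thesis
      using \<mu>'(2,3) unfolding feas[OF \<mu>'(1)] obj[OF \<mu>'(1)] by (intro exI[of _ \<mu>'] conjI)
  qed
  have up: "?fam (posterior \<nu> \<mu>', z') \<and> ?obj (posterior \<nu> \<mu>', z') = ?robj (\<mu>', z')"
    if r: "?rfeas (\<mu>', z')" for \<mu>' z'
    using r fam[OF rscale[OF r]] unfolding feas[OF rscale[OF r]] obj[OF rscale[OF r]] prod.case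
    by (intro conjI refl)
  \<comment> \<open>\<open>is_arg_min\<close> refers to the other points only through the existence
    of a strictly smaller value. The cycle from family to all densities to reduced problem and back
    shows that the three problems go below the same thresholds a.\<close>
  have feas_if_fam: "\<exists>v. ?feas v \<and> ?obj v < a" if "\<exists>v. ?fam v \<and> ?obj v < a" for a
    using that by auto
  have red_if_feas: "\<exists>v. ?rfeas v \<and> ?robj v < a" if lt: "\<exists>v. ?feas v \<and> ?obj v < a" for a
  proof -
    obtain v where v: "?feas v" "?obj v < a" using lt by (elim exE conjE)
    have "?feas (fst v, snd v)" using v(1) by simp
    from dom[OF this] obtain \<mu>' where r: "?rfeas (\<mu>', snd v)" "?robj (\<mu>', snd v) \<le> ?obj v"
      unfolding prod.collapse by (elim exE conjE)
    show ?thesis by (intro exI[of _ "(\<mu>', snd v)"] conjI r(1) le_less_trans[OF r(2) v(2)])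
  qed
  have fam_if_red: "\<exists>v. ?fam v \<and> ?obj v < a" if lt: "\<exists>v. ?rfeas v \<and> ?robj v < a" for a
  proof -
    obtain v where v: "?rfeas v" "?robj v < a" using lt by (elim exE conjE)
    \<comment> \<open>Reduced feasibility contains positivity of the scale, so the corresponding
      posterior belongs to the family.\<close>
    have "?rfeas (fst v, snd v)" using v(1) by simp
    from up[OF this] v(2) show ?thesis
      unfolding prod.collapse by (intro exI[of _ "(posterior \<nu> (fst v), snd v)"]) (elim conjE, intro conjI, assumption, simp only:)
  qed
  have fam_lt_iff: "(\<exists>v. ?fam v \<and> ?obj v < a) \<longleftrightarrow> (\<exists>v. ?rfeas v \<and> ?robj v < a)" for a
    by (rule iffI, rule red_if_feas, erule feas_if_fam, erule fam_if_red)
  have feas_lt_iff: "(\<exists>v. ?feas v \<and> ?obj v < a) \<longleftrightarrow> (\<exists>v. ?rfeas v \<and> ?robj v < a)" for a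
    by (rule iffI, erule red_if_feas, rule feas_if_fam, erule fam_if_red)
  have fam_iff: "?fam (posterior \<nu> \<mu>, z) \<longleftrightarrow> ?rfeas (\<mu>, z)"
    using feas[OF \<mu>] fam[OF \<mu>] by (simp only: prod.case simp_thms)
  have *: "is_arg_min ?obj ?fam (posterior \<nu> \<mu>, z) \<longleftrightarrow> is_arg_min ?robj ?rfeas (\<mu>, z)"
    "is_arg_min ?obj ?feas (posterior \<nu> \<mu>, z) \<longleftrightarrow> is_arg_min ?robj ?rfeas (\<mu>, z)"
    unfolding is_arg_min_def fam_lt_iff feas_lt_iff fam_iff feas[OF \<mu>] obj[OF \<mu>] by (rule refl)+
  show "(?feas (posterior \<nu> \<mu>, z) \<longleftrightarrow> ?rfeas (\<mu>, z)) \<and>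
      ?obj (posterior \<nu> \<mu>, z) = ?robj (\<mu>, z) \<and>
      (is_arg_min ?obj ?fam (posterior \<nu> \<mu>, z) \<longleftrightarrow> is_arg_min ?robj ?rfeas (\<mu>, z)) \<and>
      (is_arg_min ?obj ?feas (posterior \<nu> \<mu>, z) \<longleftrightarrow> is_arg_min ?robj ?rfeas (\<mu>, z)) \<and>
      (1 < \<nu> \<longrightarrow> integrable lborel (\<lambda>w. posterior \<nu> \<mu> w *\<^sub>R w)) \<and>
      (integrable lborel (\<lambda>w. posterior \<nu> \<mu> w *\<^sub>R w) \<longrightarrow>
        (\<integral>w. posterior \<nu> \<mu> w *\<^sub>R w \<partial>lborel) = \<mu>)"
    by (intro conjI impI feas[OF \<mu>] obj[OF \<mu>] *;
        erule integrable_posterior_mean posterior_mean)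
qed

end
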